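(* $\vec{\chi}(\mathrm{Forb}_{\mathrm{ind}}(\overset{\leftrightarrow}{K}_2,S_2^+,W_3^+))=2.$
   Context: All digraphs are finite and simple: no loops, and between two vertices at most one arc in each direction (so pairs of opposite arcs are allowed in general). $(u,v)$ denotes an arc with tail $u$ and head $v$. An acyclic $k$-coloring of a digraph $D$ is a map $c:V(D)\to S$ with $|S|=k$ such that each color class $c^{-1}(i)$, $i \in S$, induces a subdigraph without directed cycles (a digon, i.e. a pair of opposite arcs $(x,y),(y,x)$, counts as a directed cycle of length two). The dichromatic number $\vec{\chi}(D)$ is the smallest $k$ for which an acyclic $k$-coloring of $D$ exists. For a set (or list) $\mathcal{F}$ of digraphs, $\mathrm{Forb}_{\mathrm{ind}}(\mathcal{F})$ is the set of digraphs containing no induced subdigraph isomorphic to a member of $\mathcal{F}$. When the digraphs in this class have bounded dichromatic number, $\vec{\chi}(\mathrm{Forb}_{\mathrm{ind}}(\mathcal{F})):=\max\{\vec{\chi}(D) \mid D\in \mathrm{Forb}_{\mathrm{ind}}(\mathcal{F})\}$; an equality for this quantity includes the assertion that it is well defined. $\overset{\leftrightarrow}{K}_2$ is the digon: two vertices joined by arcs in both directions. $S_k^+$ is the orientation of the star with $k$ leaves in which all arcs are directed away from the center. $W_3^+$ is the digraph obtained from $S_3^+$ by connecting its three leaves by a directed cycle (directed triangle). *)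

theory Defs
  imports "Graph_Theory.Graph_Theory" "HOL-Library.Infinite_Typeclass"
begin

text \<open>
  A finite simple digraph is a \<^typ>\<open>'a pair_pre_digraph\<close> satisfying \<^const>\<open>pair_digraph\<close>:
  finite, no loops, and no parallel arcs since arcs are pairs (tail, head); opposite arcs are
  allowed. The predicate \<^const>\<open>pre_digraph.cycle\<close> is that of a directed cycle; it
  covers cycles of length two, i.e. digons.
\<close>

definition acyclic_coloring :: "'a pair_pre_digraph \<Rightarrow> 'c set \<Rightarrow> ('a \<Rightarrow> 'c) \<Rightarrow> bool" where
  "acyclic_coloring D S c \<longleftrightarrow>
     c ` pverts D \<subseteq> S \<and>
     (\<forall>i\<in>S. \<not> (\<exists>p. pre_digraph.cycle (with_proj D \<restriction> {v \<in> pverts D. c v = i}) p))"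

text \<open>Taking the colours among the natural numbers is no restriction, as colour sets are finite.\<close>

definition dichromatic_number :: "'a pair_pre_digraph \<Rightarrow> nat" where
  "dichromatic_number D =
     (LEAST k. \<exists>(S :: nat set) c. finite S \<and> card S = k \<and> acyclic_coloring D S c)"

definition Forb_ind :: "'f pair_pre_digraph set \<Rightarrow> 'a pair_pre_digraph set" where
  "Forb_ind \<F> =
     {D. pair_digraph D \<and>
         \<not> (\<exists>H. induced_subgraph H (with_proj D) \<and> (\<exists>F\<in>\<F>. digraph_iso (with_proj F) H))}"

text \<open>
  Meaningful only for nonempty classes of bounded dichromatic number:
  \<^const>\<open>Max\<close> is unspecified on empty and on infinite sets.
\<close>

definition class_dichromatic_number :: "'a pair_pre_digraph set \<Rightarrow> nat" where
  "class_dichromatic_number \<C> = Max (dichromatic_number ` \<C>)"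

definition digon :: "nat pair_pre_digraph" where
  "digon = \<lparr> pverts = {0, 1}, parcs = {(0, 1), (1, 0)} \<rparr>"

definition out_star :: "nat \<Rightarrow> nat pair_pre_digraph" where
  "out_star k = \<lparr> pverts = {0..k}, parcs = {0} \<times> {1..k} \<rparr>"

definition out_wheel3 :: "nat pair_pre_digraph" where
  "out_wheel3 = \<lparr> pverts = pverts (out_star 3),
                  parcs = parcs (out_star 3) \<union> {(1, 2), (2, 3), (3, 1)} \<rparr>"

end

theory Submission
  imports Defs
begin

text \<open>
  The three forbidden digraphs say that there are no digons, that the out-neighbourhood of every
  vertex is a tournament, and that this tournament is transitive. The lower bound is the directed
  triangle: its vertices have out-degree one, so it belongs to the class, and one colour does not
  suffice for it. The work lies in colouring every member of the class with two colours.

  The statement proved by induction on the vertex set is stronger: for each vertex \<open>v\<close> there is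
  an acyclic 2-colouring in which the closed out-neighbourhood of \<open>v\<close> is monochromatic
  (\<open>star_colourable\<close>). A subset of an out-neighbourhood is a transitive tournament, hence lies in
  the closed out-neighbourhood of its own source; so the induction hypothesis lets any part of an
  out-neighbourhood be coloured at will (\<open>star_colourable_prescribe\<close>). If some proper nonempty set
  of vertices is left by no arc, no cycle crosses its boundary, and the two sides are coloured
  separately.

  In the remaining strong case, call a proper vertex set an out-module if all its vertices have the
  same out-neighbours outside it. Two overlapping out-modules have an out-module as union, since
  otherwise there would be a digon; so the maximal ones partition the vertices. All vertices of one
  part have the same nonempty set of exits, the out-neighbours outside the part, and the exits
  form a transitive tournament. Mapping a vertex to the first of its exits gives a function under
  which any vertex reaches any part: the parts visited for ever by one orbit form together a set
  whose members have common out-neighbours, which by maximality is everything. Thus the parts are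
  arranged in a circle, and each remaining exit of a vertex lies in the next part or is also an exit
  of the next part. An arc that leaves its part therefore moves forward on the circle, and
  if it passes over or leaves the part of a given vertex \<open>x\<close>, then it ends in an exit of
  \<open>x\<close>. Consequently every cycle that avoids the exits of \<open>x\<close> stays inside one part
  (\<open>acyclic_avoiding_exits\<close>).

  It remains to give the first colour to \<open>v\<close> and its out-neighbours, and the second colour to the
  exits of \<open>a\<close>, where \<open>a\<close> is the last exit of \<open>v\<close>. The absence of digons between parts, and
  the choice of \<open>a\<close>, ensure that no part meets both sets, so the induction hypothesis extends
  the prescription to an acyclic colouring of each part. Cycles in the second colour avoid the exits
  of \<open>v\<close> and those in the first avoid the exits of \<open>a\<close>, so neither kind leaves a part.
\<close>

section \<open>Acyclicity of relations cut into pieces\<close>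

text \<open>
  Along a cycle a rank cannot keep decreasing, so a cycle never changes its piece. The rank has to be
  constant on pieces, since otherwise it could recover between two changes of piece.
\<close>

lemma acyclic_by_pieces:
  fixes rank :: "'a \<Rightarrow> nat"
  assumes rank_eq: "\<And>x y. \<lbrakk>x \<in> W; y \<in> W; M x = M y\<rbrakk> \<Longrightarrow> rank x = rank y"
    and rank_less: "\<And>x y. \<lbrakk>x \<in> W; y \<in> W; (x, y) \<in> E; M x \<noteq> M y\<rbrakk> \<Longrightarrow> rank y < rank x"
    and pieces: "\<And>x. x \<in> W \<Longrightarrow> acyclic (Restr E {y \<in> W. M y = M x})"
  shows "acyclic (Restr E W)"
proof (rule acyclicI, intro allI notI)
  fix x assume cyc: "(x, x) \<in> (Restr E W)\<^sup>+"
  have "x \<in> W"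
    using cyc by (meson IntD2 SigmaD1 tranclD)
  have "y \<in> W \<and> (rank y < rank x
      \<or> M y = M x \<and> (x, y) \<in> (Restr E {y \<in> W. M y = M x})\<^sup>+)"
    if "(x, y) \<in> (Restr E W)\<^sup>+" for y
    using that
  proof (induction rule: trancl_induct)
    case (base y)
    then show ?case
      using rank_less[of x y] \<open>x \<in> W\<close> by (cases "M y = M x") auto
  next
    case (step y z)
    then have yz: "y \<in> W" "z \<in> W" "(y, z) \<in> E"
      by auto
    then have "rank z \<le> rank y"
      using rank_less[of y z] rank_eq[of y z] by (cases "M y = M z") auto
    moreover have "(x, z) \<in> (Restr E {y \<in> W. M y = M x})\<^sup>+"
      if "(x, y) \<in> (Restr E {y \<in> W. M y = M x})\<^sup>+" "M y = M x" "M z = M x"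
      using that yz by (intro trancl_into_trancl[OF that(1)]) auto
    moreover have "rank y = rank x" if "M y = M x"
      using rank_eq that yz \<open>x \<in> W\<close> by blast
    ultimately show ?case
      using step.IH yz rank_less[of y z] by (cases "M y = M z") force+
  qed
  from this[OF cyc] have "(x, x) \<in> (Restr E {y \<in> W. M y = M x})\<^sup>+"
    by auto
  then show False
    using pieces[OF \<open>x \<in> W\<close>] by (auto simp: acyclic_def)
qed

definition acyclic_bipartition :: "'a rel \<Rightarrow> 'a set \<Rightarrow> ('a \<Rightarrow> bool) \<Rightarrow> bool" where
  "acyclic_bipartition E V c \<longleftrightarrow> (\<forall>b. acyclic (Restr E {x \<in> V. c x = b}))"

lemma acyclic_bipartition_Not:
  "acyclic_bipartition E V c \<Longrightarrow> acyclic_bipartition E V (\<lambda>x. \<not> c x)"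
  unfolding acyclic_bipartition_def
proof
  fix b assume "\<forall>b. acyclic (Restr E {x \<in> V. c x = b})"
  then have "acyclic (Restr E {x \<in> V. c x = (\<not> b)})" ..
  moreover have "{x \<in> V. c x = (\<not> b)} = {x \<in> V. (\<not> c x) = b}"
    by auto
  ultimately show "acyclic (Restr E {x \<in> V. (\<not> c x) = b})"
    by simp
qed

section \<open>Locally out-transitive relations\<close>

text \<open>
  The properties of the arc relation that the forbidden subdigraphs enforce. Each of them passes to
  vertex subsets, so that the arc relation can stay fixed while the vertex set varies.
\<close>

locale locally_out_transitive =
  fixes E :: "'a rel"
  assumes asym: "(x, y) \<in> E \<Longrightarrow> (y, x) \<notin> E"
    and comparable: "\<lbrakk>(v, a) \<in> E; (v, b) \<in> E; a \<noteq> b\<rbrakk> \<Longrightarrow> (a, b) \<in> E \<or> (b, a) \<in> E"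
    and no_triangle: "\<lbrakk>(v, a) \<in> E; (v, b) \<in> E; (v, c) \<in> E; (a, b) \<in> E; (b, c) \<in> E\<rbrakk> \<Longrightarrow> (c, a) \<notin> E"
begin

lemma out_neighbours_ends:
  assumes "finite T" "T \<noteq> {}" "T \<subseteq> E `` {v}"
  shows out_neighbours_source: "\<exists>s\<in>T. \<forall>x\<in>T. x \<noteq> s \<longrightarrow> (s, x) \<in> E"
    and out_neighbours_sink: "\<exists>s\<in>T. \<forall>x\<in>T. x \<noteq> s \<longrightarrow> (x, s) \<in> E"
proof -
  have total: "totalp_on T (\<lambda>x y. (x, y) \<in> E)"
    using assms(3) comparable by (intro totalp_onI) (meson Image_singleton_iff subsetD)
  have trans: "transp_on T (\<lambda>x y. (x, y) \<in> E)"
  proof (rule transp_onI)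
    fix x y z assume *: "x \<in> T" "y \<in> T" "z \<in> T" "(x, y) \<in> E" "(y, z) \<in> E"
    have v: "(v, x) \<in> E" "(v, y) \<in> E" "(v, z) \<in> E"
      using *(1-3) assms(3) by auto
    have "x \<noteq> z"
      using asym *(4,5) by blast
    then show "(x, z) \<in> E"
      using comparable[OF v(1,3)] no_triangle[OF v *(4,5)] by blast
  qed
  show "\<exists>s\<in>T. \<forall>x\<in>T. x \<noteq> s \<longrightarrow> (s, x) \<in> E"
    using Finite_Set.bex_least_element[OF assms(1,2), of "\<lambda>x y. (x, y) \<in> E"] total trans
    by auto
  show "\<exists>s\<in>T. \<forall>x\<in>T. x \<noteq> s \<longrightarrow> (x, s) \<in> E"
    using Finite_Set.bex_greatest_element[OF assms(1,2), of "\<lambda>x y. (x, y) \<in> E"] total trans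
    by auto
qed

definition star_colourable :: "'a set \<Rightarrow> bool" where
  "star_colourable V \<longleftrightarrow>
     (\<forall>v\<in>V. \<exists>c. acyclic_bipartition E V c \<and> c v \<and> (\<forall>w\<in>V. (v, w) \<in> E \<longrightarrow> c w))"

text \<open>
  A nonempty set of vertices in a closed out-neighbourhood has a source, and its closed
  out-neighbourhood contains the set. Exchanging the two colours gives either value of the colour.
\<close>

lemma star_colourable_prescribe:
  assumes "star_colourable V" "finite V" "T \<subseteq> V" "T \<subseteq> insert x (E `` {x})"
  shows "\<exists>c. acyclic_bipartition E V c \<and> (\<forall>w\<in>T. c w = b)"
proof -
  have "\<exists>c. acyclic_bipartition E V c \<and> (\<forall>w\<in>T. c w)"
  proof (cases "T = {}")
    case True
    show ?thesis
    proof (cases "V = {}")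
      case True
      then show ?thesis
        using \<open>T = {}\<close> by (auto simp: acyclic_bipartition_def acyclic_def)
    next
      case False
      then show ?thesis
        using \<open>T = {}\<close> assms(1) by (auto simp: star_colourable_def)
    qed
  next
    case False
    have "\<exists>s\<in>T. \<forall>w\<in>T. w \<noteq> s \<longrightarrow> (s, w) \<in> E"
    proof (cases "x \<in> T")
      case True
      then show ?thesis using assms(4) by auto
    next
      case False
      then show ?thesis
        using out_neighbours_source[of T x] \<open>T \<noteq> {}\<close> assms finite_subset by blast
    qed
    then obtain s where "s \<in> T" and s: "\<forall>w\<in>T. w \<noteq> s \<longrightarrow> (s, w) \<in> E"
      by blast
    then obtain c where "acyclic_bipartition E V c" "c s" "\<forall>w\<in>V. (s, w) \<in> E \<longrightarrow> c w"
      using assms(1,3) unfolding star_colourable_def by blast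
    moreover from this have "\<forall>w\<in>T. c w"
      using s assms(3) by (metis subsetD)
    ultimately show ?thesis
      by blast
  qed
  then obtain c where c: "acyclic_bipartition E V c" "\<forall>w\<in>T. c w"
    by blast
  show ?thesis
  proof (cases b)
    case True
    then show ?thesis using c by auto
  next
    case False
    then show ?thesis using c acyclic_bipartition_Not[OF c(1)] by blast
  qed
qed

end

section \<open>Maximal out-modules of a strong digraph\<close>

text \<open>
  Strong connectivity in its cut form: every proper nonempty vertex set is left
  by some arc. A single vertex satisfies this too but has no partition into proper nonempty parts.
\<close>

locale strong_out_transitive = locally_out_transitive E for E :: "'a rel" +
  fixes V :: "'a set"
  assumes finite_V: "finite V"
    and strong: "\<lbrakk>X \<subset> V; X \<noteq> {}\<rbrakk> \<Longrightarrow> \<exists>x\<in>X. \<exists>z\<in>V - X. (x, z) \<in> E"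
    and not_singleton: "V \<noteq> {x}"
begin

definition out_module :: "'a set \<Rightarrow> bool" where
  "out_module M \<longleftrightarrow> M \<subset> V \<and> (\<forall>x\<in>M. \<forall>y\<in>M. \<forall>z\<in>V - M. (x, z) \<in> E \<longleftrightarrow> (y, z) \<in> E)"

text \<open>
  Out-neighbours outside of the union agree because they agree with those of the common vertex
  \<open>x\<close>. If the union were everything, \<open>x\<close> would have an out-neighbour \<open>z\<close> in \<open>N\<close> but not in
  \<open>M\<close> and an out-neighbour \<open>w\<close> in \<open>M\<close> but not in \<open>N\<close>; homogeneity of the two sets then gives
  arcs between \<open>z\<close> and \<open>w\<close> in both directions.
\<close>

lemma out_module_Un:
  assumes M: "out_module M" and N: "out_module N" and x: "x \<in> M" "x \<in> N"
  shows "out_module (M \<union> N)"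
proof -
  have sub: "M \<subset> V" "N \<subset> V"
    using M N by (auto simp: out_module_def)
  have hom_M: "(a, z) \<in> E \<longleftrightarrow> (b, z) \<in> E" if "a \<in> M" "b \<in> M" "z \<in> V" "z \<notin> M" for a b z
    using M that unfolding out_module_def by blast
  have hom_N: "(a, z) \<in> E \<longleftrightarrow> (b, z) \<in> E" if "a \<in> N" "b \<in> N" "z \<in> V" "z \<notin> N" for a b z
    using N that unfolding out_module_def by blast
  have "M \<union> N \<noteq> V"
  proof
    assume un: "M \<union> N = V"
    obtain z where z: "z \<in> V" "z \<notin> M" "(x, z) \<in> E"
      using strong[OF sub(1)] hom_M x(1) by blast
    obtain w where w: "w \<in> V" "w \<notin> N" "(x, w) \<in> E"
      using strong[OF sub(2)] hom_N x(2) by blast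
    have "z \<in> N" "w \<in> M"
      using un z w by auto
    then have "(z, w) \<in> E" "(w, z) \<in> E"
      using hom_N[OF x(2) _ w(1,2)] hom_M[OF x(1) _ z(1,2)] w z by auto
    then show False
      using asym by blast
  qed
  moreover have "(a, z) \<in> E \<longleftrightarrow> (x, z) \<in> E" if "a \<in> M \<union> N" "z \<in> V - (M \<union> N)" for a z
    using that hom_M[of a x z] hom_N[of a x z] x by blast
  ultimately show ?thesis
    using sub unfolding out_module_def by blast
qed

definition module_of :: "'a \<Rightarrow> 'a set" where
  "module_of x = \<Union> {M. out_module M \<and> x \<in> M}"

text \<open>
  By finiteness there is a maximal out-module containing \<open>x\<close>; it absorbs every other one that
  contains \<open>x\<close>, hence equals their union.
\<close>

lemma out_module_module_of:
  assumes "x \<in> V"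
  shows "out_module (module_of x)" and mem_module_of: "x \<in> module_of x"
proof -
  let ?Ms = "{M. out_module M \<and> x \<in> M}"
  have "{x} \<in> ?Ms"
    using assms not_singleton[of x] by (auto simp: out_module_def)
  moreover have "finite ?Ms"
    using finite_subset[of ?Ms "Pow V"] finite_V by (auto simp: out_module_def)
  ultimately obtain M where M: "M \<in> ?Ms" and max: "\<And>N. \<lbrakk>N \<in> ?Ms; M \<subseteq> N\<rbrakk> \<Longrightarrow> M = N"
    using finite_has_maximal2[of ?Ms "{x}"] by blast
  have "N \<subseteq> M" if "N \<in> ?Ms" for N
    using max[of "M \<union> N"] out_module_Un[of M N x] M that by auto
  then have "module_of x = M"
    using M unfolding module_of_def by auto
  then show "out_module (module_of x)" "x \<in> module_of x"
    using M by auto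
qed

lemma out_module_subset_module_of: "\<lbrakk>out_module M; x \<in> M\<rbrakk> \<Longrightarrow> M \<subseteq> module_of x"
  unfolding module_of_def by auto

lemma module_of_psubset: "x \<in> V \<Longrightarrow> module_of x \<subset> V"
  using out_module_module_of(1)[of x] unfolding out_module_def by blast

lemma module_of_eq:
  assumes "x \<in> V" "y \<in> module_of x"
  shows "module_of y = module_of x"
proof -
  have y: "y \<in> V"
    using module_of_psubset[OF assms(1)] assms(2) by auto
  have "module_of x \<subseteq> module_of y"
    using out_module_subset_module_of out_module_module_of(1) assms by blast
  moreover from this have "module_of y \<subseteq> module_of x"
    using out_module_subset_module_of out_module_module_of(1)[OF y] mem_module_of[OF assms(1)] by blast
  ultimately show ?thesis by simp
qed

lemma module_of_eq_iff: "\<lbrakk>x \<in> V; y \<in> V\<rbrakk> \<Longrightarrow> module_of y = module_of x \<longleftrightarrow> y \<in> module_of x"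
  using module_of_eq mem_module_of by blast

definition exits :: "'a \<Rightarrow> 'a set" where
  "exits x = {z \<in> V - module_of x. (x, z) \<in> E}"

lemma exits_cong:
  assumes "x \<in> V" "y \<in> V" "module_of x = module_of y"
  shows "exits x = exits y"
proof -
  have "x \<in> module_of y" "y \<in> module_of y"
    using assms mem_module_of by blast+
  then show ?thesis
    using out_module_module_of(1)[OF assms(2)] assms(3)
    unfolding exits_def out_module_def by blast
qed

lemma exits_nonempty: "x \<in> V \<Longrightarrow> exits x \<noteq> {}"
proof -
  assume x: "x \<in> V"
  obtain y z where y: "y \<in> module_of x" and z: "z \<in> V - module_of x" "(y, z) \<in> E"
    using strong[OF module_of_psubset[OF x]] mem_module_of[OF x] by blast
  have "y \<in> V" using y module_of_psubset[OF x] by auto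
  have "z \<in> exits y"
    using z module_of_eq[OF x y] by (simp add: exits_def)
  then show ?thesis
    using exits_cong[OF x \<open>y \<in> V\<close>] module_of_eq[OF x y] by auto
qed

lemma exits_subset: "exits x \<subseteq> V" "exits x \<subseteq> E `` {x}" "finite (exits x)"
  using finite_V by (auto simp: exits_def)

text \<open>
  The quotient by the parts has no digons: if \<open>y\<close> is an exit of \<open>x\<close> and conversely some vertex of
  the part of \<open>x\<close> is an exit of the part of \<open>y\<close>, then homogeneity lets the two arcs be moved
  to the same pair of vertices.
\<close>

lemma exits_asym:
  assumes "x \<in> V" "y \<in> exits x" "y' \<in> V" "module_of y' = module_of y" "x' \<in> exits y'"
    "module_of x' = module_of x"
  shows False
proof -
  have V: "x' \<in> V" "y \<in> V"
    using assms exits_subset(1) by blast+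
  have "y \<in> exits x'"
    using exits_cong[OF V(1) assms(1)] assms by simp
  moreover have "x' \<in> exits y"
    using exits_cong[OF V(2) assms(3)] assms by simp
  ultimately show False
    using asym by (auto simp: exits_def)
qed

definition first_exit :: "'a \<Rightarrow> 'a" where
  "first_exit x = (SOME s. s \<in> exits x \<and> (\<forall>z\<in>exits x. z \<noteq> s \<longrightarrow> (s, z) \<in> E))"

text \<open>
  The second claim makes the circular arrangement of the parts: apart from the first exit itself,
  every exit of \<open>x\<close> is an out-neighbour of the first exit, so it is either in the same part as the
  first exit or again an exit one step further.
\<close>

lemma first_exit:
  assumes "x \<in> V"
  shows first_exit_mem: "first_exit x \<in> exits x"
    and exits_first_exit: "exits x \<subseteq> module_of (first_exit x) \<union> exits (first_exit x)"
    and first_exit_in: "first_exit x \<in> V"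
proof -
  have "\<exists>s. s \<in> exits x \<and> (\<forall>z\<in>exits x. z \<noteq> s \<longrightarrow> (s, z) \<in> E)"
    using out_neighbours_source[OF exits_subset(3) exits_nonempty[OF assms] exits_subset(2)] by blast
  then have *: "first_exit x \<in> exits x"
      "\<forall>z\<in>exits x. z \<noteq> first_exit x \<longrightarrow> (first_exit x, z) \<in> E"
    unfolding first_exit_def by (rule someI2_ex, blast)+
  show "first_exit x \<in> exits x" by fact
  then show V: "first_exit x \<in> V"
    using exits_subset(1) by blast
  show "exits x \<subseteq> module_of (first_exit x) \<union> exits (first_exit x)"
    using *(2) mem_module_of[OF V] exits_subset(1)[of x] by (auto simp: exits_def)
qed

lemma first_exit_cong: "\<lbrakk>x \<in> V; y \<in> V; module_of x = module_of y\<rbrakk> \<Longrightarrow> first_exit x = first_exit y"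
  using exits_cong[of x y] unfolding first_exit_def by simp

lemma iterate_in: "x \<in> V \<Longrightarrow> (first_exit ^^ k) x \<in> V"
  by (induction k) (auto intro: first_exit_in)

text \<open>
  Let \<open>U w\<close> be the union of the parts visited by the orbit of \<open>w\<close>. For a \<open>w\<close> on the orbit of
  \<open>y\<close> with \<open>U w\<close> smallest, every later point of the orbit has the same union. An exit that is
  never visited remains an exit for ever, so the vertices of \<open>U w\<close> have the same out-neighbours
  outside of \<open>U w\<close>. As \<open>U w\<close> comprises more than one part, maximality forces it to be \<open>V\<close>.
\<close>

lemma iterates_reach_module:
  assumes "x \<in> V" "y \<in> V"
  shows "\<exists>k. (first_exit ^^ k) y \<in> module_of x"
proof -
  define U where "U y = (\<Union>k. module_of ((first_exit ^^ k) y))" for y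
  have U_sub: "U w \<subseteq> V" if "w \<in> V" for w
    unfolding U_def using module_of_psubset iterate_in[OF that] by blast
  have U_iter: "U ((first_exit ^^ k) w) \<subseteq> U w" for k w
  proof -
    have "(first_exit ^^ j) ((first_exit ^^ k) w) = (first_exit ^^ (j + k)) w" for j
      by (simp add: funpow_add)
    then show ?thesis
      unfolding U_def by auto
  qed
  \<comment> \<open>The orbit is entered late enough that no part visited by it is ever lost again.\<close>
  define k where "k = (ARG_MIN (\<lambda>k. card (U ((first_exit ^^ k) y))) k. True)"
  define w where "w = (first_exit ^^ k) y"
  have w: "w \<in> V"
    unfolding w_def using iterate_in[OF assms(2)] .
  have min: "card (U w) \<le> card (U ((first_exit ^^ j) w))" for j
    using arg_min_nat_le[of "\<lambda>_. True" "j + k" "\<lambda>k. card (U ((first_exit ^^ k) y))"]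
    unfolding w_def k_def[symmetric] by (simp add: funpow_add)
  have U_eq: "U ((first_exit ^^ j) w) = U w" for j
    using card_seteq[OF finite_subset[OF U_sub[OF w] finite_V] U_iter min] .
  have exit_all: "z \<in> exits ((first_exit ^^ j) u)" if "u \<in> V" "z \<in> exits u" "z \<notin> U u" for u z j
  proof (induction j)
    case (Suc j)
    have "z \<notin> module_of (first_exit ((first_exit ^^ j) u))"
      using that(3) unfolding U_def by (auto dest: spec[of _ "Suc j"])
    then show ?case
      using exits_first_exit[OF iterate_in[OF that(1), of j]] Suc.IH by auto
  qed (use that in simp)
  have one: "(b, z) \<in> E" if a: "a \<in> U w" and b: "b \<in> U w" and z: "z \<in> V - U w" and "(a, z) \<in> E" for a b z
  proof -
    obtain i where i: "a \<in> module_of ((first_exit ^^ i) w)"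
      using a by (auto simp: U_def)
    let ?u = "(first_exit ^^ i) w"
    have u: "?u \<in> V" "U ?u = U w"
      using iterate_in[OF w] U_eq by auto
    obtain j where j: "b \<in> module_of ((first_exit ^^ j) ?u)"
      using b unfolding u(2)[symmetric] by (auto simp: U_def)
    let ?t = "(first_exit ^^ j) ?u"
    have t: "?t \<in> V"
      using iterate_in[OF u(1)] .
    have ab: "a \<in> V" "b \<in> V"
      using a b U_sub[OF w] by auto
    have "z \<notin> module_of ?u"
      using z i unfolding U_def by blast
    then have "z \<in> exits a"
      using z \<open>(a, z) \<in> E\<close> module_of_eq[OF u(1) i] by (simp add: exits_def)
    then have "z \<in> exits ?u"
      using exits_cong[OF ab(1) u(1) module_of_eq[OF u(1) i]] by simp
    then have "z \<in> exits ?t"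
      using exit_all[OF u(1)] z u(2) by blast
    then have "z \<in> exits b"
      using exits_cong[OF ab(2) t module_of_eq[OF t j]] by simp
    then show ?thesis
      by (simp add: exits_def)
  qed
  have "U w = V"
  proof (rule ccontr)
    assume "U w \<noteq> V"
    then have "out_module (U w)"
      using U_sub[OF w] one unfolding out_module_def by blast
    moreover have "w \<in> U w" "first_exit w \<in> U w"
      using mem_module_of[OF w] mem_module_of[OF first_exit_in[OF w]] unfolding U_def
      by (auto intro: exI[of _ 0] exI[of _ "Suc 0"])
    ultimately have "first_exit w \<in> module_of w"
      using out_module_subset_module_of by blast
    then show False
      using first_exit_mem[OF w] by (simp add: exits_def)
  qed
  then obtain j where "x \<in> module_of ((first_exit ^^ j) w)"
    using assms(1) by (auto simp: U_def)
  then have "module_of x = module_of ((first_exit ^^ j) w)"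
    using module_of_eq iterate_in[OF w] by blast
  then have "(first_exit ^^ (j + k)) y \<in> module_of x"
    using mem_module_of[OF iterate_in[OF w, of j]] by (simp add: w_def funpow_add)
  then show ?thesis ..
qed

text \<open>
  The distance on the circle of parts from \<open>y\<close> forward to the part of \<open>x\<close>.
\<close>

definition steps :: "'a \<Rightarrow> 'a \<Rightarrow> nat" where
  "steps x y = (LEAST k. (first_exit ^^ k) y \<in> module_of x)"

lemma steps_eq_0: "y \<in> module_of x \<Longrightarrow> steps x y = 0"
  unfolding steps_def by simp

lemma steps_eq_Suc:
  assumes "x \<in> V" "y \<in> V" "y \<notin> module_of x"
  shows "steps x y = Suc (steps x (first_exit y))"
proof -
  obtain k where "(first_exit ^^ k) y \<in> module_of x"
    using iterates_reach_module[OF assms(1,2)] by blast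
  then show ?thesis
    using Least_Suc[of "\<lambda>k. (first_exit ^^ k) y \<in> module_of x" k] assms(3)
    unfolding steps_def by (simp add: funpow_Suc_right del: funpow.simps)
qed

lemma steps_cong:
  assumes "x \<in> V" "y \<in> V" "z \<in> V" "module_of y = module_of z"
  shows "steps x y = steps x z"
proof (cases "y \<in> module_of x")
  case True
  then have "z \<in> module_of x"
    using assms module_of_eq_iff by metis
  then show ?thesis
    using True steps_eq_0 by simp
next
  case False
  then have "z \<notin> module_of x"
    using assms module_of_eq_iff by metis
  then show ?thesis
    using False assms steps_eq_Suc first_exit_cong by metis
qed

text \<open>
  Following the first exits from \<open>y\<close>, the vertex \<open>z\<close> stays an exit until its part is visited. This
  happens no later than the walk reaches the part of \<open>x\<close>, for otherwise \<open>z\<close> would be an exit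
  of \<open>x\<close>.
\<close>

lemma steps_decrease:
  assumes "x \<in> V" "y \<in> V" "z \<in> exits y" "z \<notin> exits x"
  shows "steps x z < steps x y"
  using assms(2,3)
proof (induction "steps x y" arbitrary: y)
  case 0
  have "y \<in> module_of x"
  proof (rule ccontr)
    assume "y \<notin> module_of x"
    from steps_eq_Suc[OF assms(1) 0(2) this] 0(1) show False
      by linarith
  qed
  then have "exits y = exits x"
    by (intro exits_cong[OF 0(2) assms(1)] module_of_eq[OF assms(1)])
  then have "z \<in> exits x"
    using 0(3) by blast
  then show ?case
    using assms(4) by simp
next
  case (Suc n)
  have "y \<notin> module_of x"
    using Suc.hyps(2) steps_eq_0[of y x] by linarith
  then have steps_y: "steps x y = Suc (steps x (first_exit y))"
    by (rule steps_eq_Suc[OF assms(1) Suc.prems(1)])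
  have y': "first_exit y \<in> V"
    using first_exit_in[OF Suc.prems(1)] .
  have "z \<in> V"
    using Suc.prems(2) exits_subset(1) by blast
  consider "z \<in> module_of (first_exit y)" | "z \<in> exits (first_exit y)"
    using exits_first_exit[OF Suc.prems(1)] Suc.prems(2) by blast
  then show ?case
  proof cases
    case 1
    then have "steps x z = steps x (first_exit y)"
      using steps_cong[OF assms(1) \<open>z \<in> V\<close> y' module_of_eq[OF y']] by simp
    then show ?thesis
      using steps_y by simp
  next
    case 2
    then have "steps x z < steps x (first_exit y)"
      using Suc.hyps(1)[OF _ y'] Suc.hyps(2) steps_y by simp
    then show ?thesis
      using steps_y by simp
  qed
qed

text \<open>
  The set \<open>exits x\<close> cuts the circle of parts open: on its complement the number of steps to the
  part of \<open>x\<close> is a rank that decreases along every arc between different parts.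
\<close>

lemma acyclic_avoiding_exits:
  assumes "x \<in> V" "W \<subseteq> V" "W \<inter> exits x = {}"
    and "\<And>y. y \<in> W \<Longrightarrow> acyclic (Restr E (W \<inter> module_of y))"
  shows "acyclic (Restr E W)"
proof (rule acyclic_by_pieces[where M = module_of and rank = "steps x"])
  fix y z assume yz: "y \<in> W" "z \<in> W"
  show "steps x y = steps x z" if "module_of y = module_of z"
    using steps_cong[OF assms(1)] that yz assms(2) by blast
  show "steps x z < steps x y" if "(y, z) \<in> E" "module_of y \<noteq> module_of z"
  proof (rule steps_decrease[OF assms(1)])
    show "y \<in> V" "z \<notin> exits x" "z \<in> exits y"
      using yz that assms(2,3) module_of_eq[of y z] by (auto simp: exits_def)
  qed
next
  fix y assume "y \<in> W"
  then have "{z \<in> W. module_of z = module_of y} = W \<inter> module_of y"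
    using module_of_eq_iff assms(2) by blast
  then show "acyclic (Restr E {z \<in> W. module_of z = module_of y})"
    using assms(4)[OF \<open>y \<in> W\<close>] by simp
qed

text \<open>
  The closed out-neighbourhood \<open>star\<close> of \<open>v\<close> gets the colour \<open>True\<close> and the exits of the last exit
  \<open>a\<close> of \<open>v\<close> get \<open>False\<close>. So each colour class avoids the exits of one vertex, and
  its cycles are confined to single parts, where the colouring is acyclic by assumption.
\<close>

lemma star_colourable_if_modules:
  assumes IH: "\<And>y. y \<in> V \<Longrightarrow> star_colourable (module_of y)"
  shows "star_colourable V"
  unfolding star_colourable_def
proof
  fix v assume v: "v \<in> V"
  \<comment> \<open>As a sink, \<open>a\<close> has no exit of \<open>v\<close> among its own exits; this separates the two sets.\<close>
  obtain a where a: "a \<in> exits v" and sink: "\<forall>z\<in>exits v. z \<noteq> a \<longrightarrow> (z, a) \<in> E"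
    using out_neighbours_sink[OF exits_subset(3) exits_nonempty[OF v] exits_subset(2)] ..
  have aV: "a \<in> V"
    using a exits_subset(1) by blast
  define star where "star = insert v (V \<inter> E `` {v})"
  have star_sub: "star \<subseteq> V" "star \<subseteq> insert v (E `` {v})" "star \<subseteq> module_of v \<union> exits v" "exits v \<subseteq> star"
    using v mem_module_of[OF v] by (auto simp: star_def exits_def)
  have separate: "star \<inter> module_of y = {} \<or> exits a \<inter> module_of y = {}" if y: "y \<in> V" for y
  proof (rule ccontr)
    assume "\<not> ?thesis"
    then obtain s t where s: "s \<in> star" "s \<in> module_of y" and t: "t \<in> exits a" "t \<in> module_of y"
      by blast
    have st: "module_of s = module_of t"
      using module_of_eq[OF y] s t by simp
    have sV: "s \<in> V" and tV: "t \<in> V"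
      using s t star_sub(1) exits_subset(1) by blast+
    show False
    proof (cases "s \<in> module_of v")
      case True
      then have "module_of t = module_of v"
        using module_of_eq[OF v] st by simp
      then show False
        using exits_asym[OF v a aV refl t(1)] by simp
    next
      case False
      then have "s \<in> exits v"
        using s(1) star_sub(3) by blast
      \<comment> \<open>Here \<open>s\<close> is an exit of \<open>v\<close> other than the sink \<open>a\<close>, so \<open>a\<close> is an exit of \<open>s\<close>, while \<open>t\<close> in
        the part of \<open>s\<close> is an exit of \<open>a\<close>.\<close>
      have "module_of s \<noteq> module_of a"
        using t(1) st mem_module_of[OF tV] by (auto simp: exits_def)
      then have "s \<noteq> a" "a \<notin> module_of s"
        using module_of_eq[OF sV] by auto
      then have "a \<in> exits s"
        using sink \<open>s \<in> exits v\<close> aV by (simp add: exits_def)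
      then show False
        using exits_asym[OF sV _ aV refl t(1)] st by simp
    qed
  qed
  have "\<forall>N\<in>module_of ` V. \<exists>c. acyclic_bipartition E N c
      \<and> (\<forall>w\<in>N. (w \<in> star \<longrightarrow> c w) \<and> (w \<in> exits a \<longrightarrow> \<not> c w))"
  proof
    fix N assume N: "N \<in> module_of ` V"
    obtain y where y: "y \<in> V" "N = module_of y"
      using N by blast
    have N': "star_colourable N" "finite N"
      using IH y finite_V finite_subset module_of_psubset by blast+
    consider "exits a \<inter> N = {}" | "star \<inter> N = {}"
      using separate[OF y(1)] y(2) by blast
    then show "\<exists>c. acyclic_bipartition E N c
        \<and> (\<forall>w\<in>N. (w \<in> star \<longrightarrow> c w) \<and> (w \<in> exits a \<longrightarrow> \<not> c w))"
    proof cases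
      case 1
      obtain c where "acyclic_bipartition E N c" "\<forall>w\<in>star \<inter> N. c w = True"
        using star_colourable_prescribe[OF N', of "star \<inter> N" v True] star_sub(2) by blast
      then show ?thesis using 1 by blast
    next
      case 2
      obtain c where "acyclic_bipartition E N c" "\<forall>w\<in>exits a \<inter> N. c w = False"
        using star_colourable_prescribe[OF N', of "exits a \<inter> N" a False] exits_subset(2)[of a] by blast
      then show ?thesis using 2 by blast
    qed
  qed
  from bchoice[OF this] obtain col where col: "\<forall>N\<in>module_of ` V. acyclic_bipartition E N (col N)
      \<and> (\<forall>w\<in>N. (w \<in> star \<longrightarrow> col N w) \<and> (w \<in> exits a \<longrightarrow> \<not> col N w))"
    ..
  define c where "c x = col (module_of x) x" for x
  have c_star: "c w" if "w \<in> star" for w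
    using col that star_sub(1) mem_module_of unfolding c_def by blast
  have c_exits: "\<not> c w" if "w \<in> exits a" for w
    using col that exits_subset(1) mem_module_of unfolding c_def by blast
  have pieces: "acyclic (Restr E ({x \<in> V. c x = b} \<inter> module_of y))" if y: "y \<in> V" for b y
  proof -
    have "{x \<in> V. c x = b} \<inter> module_of y = {x \<in> module_of y. col (module_of y) x = b}"
      using module_of_eq[OF y] module_of_psubset[OF y] unfolding c_def by auto
    then show ?thesis
      using col y unfolding acyclic_bipartition_def by auto
  qed
  have "acyclic (Restr E {x \<in> V. c x = b})" for b
  proof (rule acyclic_avoiding_exits[where x = "if b then a else v"])
    show "(if b then a else v) \<in> V"
      using aV v by simp
    show "{x \<in> V. c x = b} \<inter> exits (if b then a else v) = {}"
      using c_exits c_star star_sub(4) by auto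
  qed (use pieces in auto)
  then show "\<exists>c. acyclic_bipartition E V c \<and> c v \<and> (\<forall>w\<in>V. (v, w) \<in> E \<longrightarrow> c w)"
    using c_star unfolding acyclic_bipartition_def star_def by (intro exI[of _ c]) auto
qed

end

section \<open>Two colours suffice\<close>

context locally_out_transitive
begin

text \<open>
  No arc leads from \<open>X\<close> to the rest, so no cycle meets both. The out-neighbourhood of \<open>v\<close> may meet
  both sides, which is why its trace on each side has to be prescribed.
\<close>

lemma star_colourable_if_not_strong:
  assumes "finite V" "X \<subset> V" and closed: "\<And>x z. \<lbrakk>x \<in> X; z \<in> V - X\<rbrakk> \<Longrightarrow> (x, z) \<notin> E"
    and "star_colourable X" "star_colourable (V - X)"
  shows "star_colourable V"
  unfolding star_colourable_def
proof
  fix v assume v: "v \<in> V"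
  define star where "star = insert v (V \<inter> E `` {v})"
  have fin: "finite X" "finite (V - X)"
    using assms finite_subset by blast+
  obtain c1 where c1: "acyclic_bipartition E X c1" "\<forall>w\<in>star \<inter> X. c1 w = True"
    using star_colourable_prescribe[OF assms(4) fin(1), of "star \<inter> X" v True] by (auto simp: star_def)
  obtain c2 where c2: "acyclic_bipartition E (V - X) c2" "\<forall>w\<in>star \<inter> (V - X). c2 w = True"
    using star_colourable_prescribe[OF assms(5) fin(2), of "star \<inter> (V - X)" v True]
    by (auto simp: star_def)
  define c where "c x = (if x \<in> X then c1 x else c2 x)" for x
  have "acyclic (Restr E {x \<in> V. c x = b})" for b
  proof (rule acyclic_by_pieces[where M = "\<lambda>x. x \<in> X" and rank = "\<lambda>x. if x \<in> X then 0 else 1"])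
    fix x assume "x \<in> {x \<in> V. c x = b}"
    have "{y \<in> {x \<in> V. c x = b}. (y \<in> X) = (x \<in> X)}
        = (if x \<in> X then {y \<in> X. c1 y = b} else {y \<in> V - X. c2 y = b})"
      using assms(2) by (auto simp: c_def)
    then show "acyclic (Restr E {y \<in> {x \<in> V. c x = b}. (y \<in> X) = (x \<in> X)})"
      using c1(1) c2(1) unfolding acyclic_bipartition_def by auto
  qed (use closed in auto)
  moreover have "c w" if "w \<in> star" for w
    using that c1(2) c2(2) v by (auto simp: c_def star_def)
  ultimately show "\<exists>c. acyclic_bipartition E V c \<and> c v \<and> (\<forall>w\<in>V. (v, w) \<in> E \<longrightarrow> c w)"
    unfolding acyclic_bipartition_def star_def by (intro exI[of _ c]) auto
qed

theorem star_colourable: "finite V \<Longrightarrow> star_colourable V"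
proof (induction V rule: finite_psubset_induct)
  case (psubset V)
  consider x where "V = {x}" | X where "X \<subset> V" "X \<noteq> {}" "\<And>x z. \<lbrakk>x \<in> X; z \<in> V - X\<rbrakk> \<Longrightarrow> (x, z) \<notin> E"
    | "\<And>x. V \<noteq> {x}" "\<And>X. \<lbrakk>X \<subset> V; X \<noteq> {}\<rbrakk> \<Longrightarrow> \<exists>x\<in>X. \<exists>z\<in>V - X. (x, z) \<in> E"
    by metis
  then show ?case
  proof cases
    case 1
    have "acyclic (Restr E {y \<in> V. b})" for b
    proof -
      have "Restr E {y \<in> V. b} = {}"
        using asym 1 by auto
      then show ?thesis
        by (simp add: acyclic_def)
    qed
    then show ?thesis
      unfolding star_colourable_def acyclic_bipartition_def
      by (intro ballI exI[of _ "\<lambda>_. True"]) simp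
  next
    case (2 X)
    have "V - X \<subset> V"
      using 2(1,2) by auto
    then show ?thesis
      using psubset.IH 2(1) by (intro star_colourable_if_not_strong[OF psubset.hyps 2(1) 2(3)])
  next
    case 3
    interpret strong_out_transitive E V
      by unfold_locales (fact psubset.hyps, fact 3(2), fact 3(1))
    show ?thesis
      by (intro star_colourable_if_modules psubset.IH module_of_psubset)
  qed
qed

end

section \<open>From digraphs to arc relations\<close>

lemma no_cycle_iff_acyclic:
  assumes "pair_wf_digraph D"
  shows "\<not> (\<exists>p. pre_digraph.cycle (with_proj D \<restriction> S) p) \<longleftrightarrow> acyclic (Restr (parcs D) S)"
proof -
  interpret pair_wf_digraph D by fact
  interpret I: wf_digraph "with_proj D \<restriction> S"
    by (rule wellformed_induce_subgraph)
  have ends: "arcs_ends (with_proj D \<restriction> S) = Restr (parcs D) S"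
    by (auto simp: arcs_ends_conv)
  have "(\<exists>p. I.cycle p) \<longleftrightarrow> (\<exists>p u. I.awalk u p u \<and> p \<noteq> [])"
    using I.closed_w_imp_cycle unfolding I.closed_w_def I.cycle_def by blast
  also have "\<dots> \<longleftrightarrow> (\<exists>u. (u, u) \<in> (Restr (parcs D) S)\<^sup>+)"
    using I.reachable1_awalk unfolding ends by blast
  finally show ?thesis
    by (simp add: acyclic_def)
qed

definition induced_embedding :: "'f pair_pre_digraph \<Rightarrow> 'a pair_pre_digraph \<Rightarrow> ('f \<Rightarrow> 'a) \<Rightarrow> bool" where
  "induced_embedding F D f \<longleftrightarrow> inj_on f (pverts F) \<and> f ` pverts F \<subseteq> pverts D \<and>
     (\<forall>u\<in>pverts F. \<forall>v\<in>pverts F. (u, v) \<in> parcs F \<longleftrightarrow> (f u, f v) \<in> parcs D)"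

text \<open>
  An isomorphism onto a subdigraph of a digraph whose arcs are pairs is determined by its vertex map,
  since it must send an arc to the pair of images of its ends.
\<close>

lemma contains_induced_iff:
  assumes F: "pair_wf_digraph F" and D: "pair_wf_digraph D"
  shows "(\<exists>H. induced_subgraph H (with_proj D) \<and> digraph_iso (with_proj F) H) \<longleftrightarrow>
    (\<exists>f. induced_embedding F D f)"
    (is "?L \<longleftrightarrow> ?R")
proof
  interpret F: pair_wf_digraph F by fact
  interpret D: pair_wf_digraph D by fact
  assume ?L
  then obtain h where ind: "induced_subgraph (app_iso h (with_proj F)) (with_proj D)"
    and h: "F.digraph_isomorphism h"
    unfolding digraph_iso_def by blast
  have proj: "iso_tail h = fst" "iso_head h = snd"
    using ind by (auto simp: induced_subgraph_def subgraph_def compatible_def)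
  have verts: "iso_verts h ` pverts F \<subseteq> pverts D"
    using ind by (auto simp: induced_subgraph_def subgraph_def)
  have arcs: "iso_arcs h ` parcs F
      = {e \<in> parcs D. fst e \<in> iso_verts h ` pverts F \<and> snd e \<in> iso_verts h ` pverts F}"
    using ind by (auto simp: induced_subgraph_def)
  have inj: "inj_on (iso_verts h) (pverts F)"
    and arc_map: "\<And>e. e \<in> parcs F \<Longrightarrow> iso_arcs h e = (iso_verts h (fst e), iso_verts h (snd e))"
    using h by (auto simp: F.digraph_isomorphism_def proj prod_eq_iff)
  have "(u, v) \<in> parcs F \<longleftrightarrow> (iso_verts h u, iso_verts h v) \<in> parcs D"
    if "u \<in> pverts F" "v \<in> pverts F" for u v
  proof
    assume "(u, v) \<in> parcs F"
    then show "(iso_verts h u, iso_verts h v) \<in> parcs D"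
      using arcs arc_map[of "(u, v)"] by force
  next
    assume "(iso_verts h u, iso_verts h v) \<in> parcs D"
    then have "(iso_verts h u, iso_verts h v) \<in> iso_arcs h ` parcs F"
      using arcs that by auto
    then obtain e where e: "e \<in> parcs F" "iso_verts h u = iso_verts h (fst e)"
        "iso_verts h v = iso_verts h (snd e)"
      using arc_map by auto
    then have "u = fst e" "v = snd e"
      using inj_onD[OF inj] that F.arc_fst_in_verts F.arc_snd_in_verts by blast+
    then show "(u, v) \<in> parcs F"
      using e(1) by simp
  qed
  then show ?R
    using inj verts unfolding induced_embedding_def by blast
next
  interpret F: pair_wf_digraph F by fact
  interpret D: pair_wf_digraph D by fact
  assume ?R
  then obtain f where inj: "inj_on f (pverts F)" and verts: "f ` pverts F \<subseteq> pverts D"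
    and arcs: "\<And>u v. \<lbrakk>u \<in> pverts F; v \<in> pverts F\<rbrakk> \<Longrightarrow> (u, v) \<in> parcs F \<longleftrightarrow> (f u, f v) \<in> parcs D"
    unfolding induced_embedding_def by blast
  define h where "h = \<lparr>iso_verts = f, iso_arcs = map_prod f f, iso_head = snd, iso_tail = fst\<rparr>"
  have "inj_on (map_prod f f) (parcs F)"
    by (rule inj_on_subset[OF map_prod_inj_on[OF inj inj]])
      (auto dest: F.in_arcsD1 F.in_arcsD2)
  then have iso: "F.digraph_isomorphism h"
    using inj F.wf_digraph_axioms by (auto simp: F.digraph_isomorphism_def h_def)
  have arcs_eq: "map_prod f f ` parcs F
      = {e \<in> parcs D. fst e \<in> f ` pverts F \<and> snd e \<in> f ` pverts F}" (is "_ = ?A")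
  proof
    show "map_prod f f ` parcs F \<subseteq> ?A"
      using arcs by (auto dest: F.in_arcsD1 F.in_arcsD2)
    show "?A \<subseteq> map_prod f f ` parcs F"
    proof
      fix e assume "e \<in> ?A"
      then obtain u v where "e = (f u, f v)" "u \<in> pverts F" "v \<in> pverts F" "(f u, f v) \<in> parcs D"
        by (cases e) auto
      then show "e \<in> map_prod f f ` parcs F"
        using arcs[of u v] by force
    qed
  qed
  have "app_iso h (with_proj F) = with_proj D \<restriction> (f ` pverts F)"
    unfolding app_iso_def induce_subgraph_def by (simp add: h_def arcs_eq)
  moreover have "induced_subgraph (with_proj D \<restriction> (f ` pverts F)) (with_proj D)"
    using D.induced_induce verts by auto
  ultimately show ?L
    using iso unfolding digraph_iso_def by metis
qed

lemma mem_Forb_ind_iff: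
  assumes "\<forall>F\<in>\<F>. pair_wf_digraph F"
  shows "D \<in> Forb_ind \<F> \<longleftrightarrow> pair_digraph D \<and> (\<forall>F\<in>\<F>. \<forall>f. \<not> induced_embedding F D f)"
proof (cases "pair_digraph D")
  case True
  have "(\<exists>H. induced_subgraph H (with_proj D) \<and> digraph_iso (with_proj F) H)
      \<longleftrightarrow> (\<exists>f. induced_embedding F D f)" if "F \<in> \<F>" for F
    using contains_induced_iff assms that pair_digraph.pair_wf_digraph[OF True] by blast
  then show ?thesis
    using True unfolding Forb_ind_def by blast
qed (simp add: Forb_ind_def)

lemma pair_wf_digraph_forbidden:
  "\<forall>F\<in>{digon, out_star 2, out_wheel3}. pair_wf_digraph F"
proof -
  have "pair_wf_digraph digon"
    by unfold_locales (auto simp: digon_def)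
  moreover have "pair_wf_digraph (out_star 2)"
    by unfold_locales (auto simp: out_star_def)
  moreover have "pair_wf_digraph out_wheel3"
    by unfold_locales (auto simp: out_star_def out_wheel3_def)
  ultimately show ?thesis
    by simp
qed

text \<open>
  A violation of one of the three properties is an induced copy of one of the three forbidden
  digraphs. Excluding the digon first guarantees that the copies of the star and of the wheel have
  no further arcs, hence are induced.
\<close>

lemma Forb_ind_locally_out_transitive:
  assumes "D \<in> Forb_ind {digon, out_star 2, out_wheel3}"
  shows "locally_out_transitive (parcs D)"
proof -
  interpret pair_digraph D
    using assms by (simp add: Forb_ind_def)
  have no_embedding: "\<not> induced_embedding digon D f" "\<not> induced_embedding (out_star 2) D f"
    "\<not> induced_embedding out_wheel3 D f" for f
    using assms mem_Forb_ind_iff[OF pair_wf_digraph_forbidden, of D] by auto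
  have loop: "(x, x) \<notin> parcs D" for x
    using no_loops'[of x x] by blast
  have asym: "(y, x) \<notin> parcs D" if "(x, y) \<in> parcs D" for x y
  proof
    assume "(y, x) \<in> parcs D"
    then have "induced_embedding digon D ((!) [x, y])"
      using that loop in_arcsD1[OF that] in_arcsD2[OF that]
      by (auto simp: induced_embedding_def digon_def)
    then show False
      using no_embedding(1) by blast
  qed
  show ?thesis
  proof
    show "(y, x) \<notin> parcs D" if "(x, y) \<in> parcs D" for x y
      using asym that .
    show "(a, b) \<in> parcs D \<or> (b, a) \<in> parcs D"
      if "(v, a) \<in> parcs D" "(v, b) \<in> parcs D" "a \<noteq> b" for v a b
    proof -
      have verts: "pverts (out_star 2) = {0, 1, 2}" "parcs (out_star 2) = {(0, 1), (0, 2)}"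
        by (auto simp: out_star_def)
      have ne: "v \<noteq> a" "v \<noteq> b"
        using that loop by auto
      show ?thesis
      proof (rule ccontr)
        assume "\<not> ?thesis"
        then have "induced_embedding (out_star 2) D ((!) [v, a, b])"
          using that asym[OF that(1)] asym[OF that(2)] loop ne
            in_arcsD1[OF that(1)] in_arcsD2[OF that(1)] in_arcsD2[OF that(2)]
          unfolding induced_embedding_def verts by auto
        then show False
          using no_embedding(2) by blast
      qed
    qed
    show "(c, a) \<notin> parcs D"
      if "(v, a) \<in> parcs D" "(v, b) \<in> parcs D" "(v, c) \<in> parcs D" "(a, b) \<in> parcs D" "(b, c) \<in> parcs D"
      for v a b c
    proof
      assume ca: "(c, a) \<in> parcs D"
      have verts: "pverts out_wheel3 = {0, 1, 2, 3}"
          "parcs out_wheel3 = {(0, 1), (0, 2), (0, 3), (1, 2), (2, 3), (3, 1)}"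
        by (auto simp: out_star_def out_wheel3_def)
      have ne: "v \<noteq> a" "v \<noteq> b" "v \<noteq> c" "a \<noteq> b" "b \<noteq> c" "a \<noteq> c"
        using that ca loop by auto
      have "induced_embedding out_wheel3 D ((!) [v, a, b, c])"
        using that ca that[THEN asym] asym[OF ca] loop ne
          in_arcsD1[OF that(1)] that(1-3)[THEN in_arcsD2]
        unfolding induced_embedding_def verts by auto
      then show False
        using no_embedding(3) by blast
    qed
  qed
qed

lemma acyclic_coloring_iff:
  assumes "pair_wf_digraph D"
  shows "acyclic_coloring D S c \<longleftrightarrow>
    c ` pverts D \<subseteq> S \<and> (\<forall>i\<in>S. acyclic (Restr (parcs D) {v \<in> pverts D. c v = i}))"
  unfolding acyclic_coloring_def no_cycle_iff_acyclic[OF assms] ..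

lemma dichromatic_number_le_two:
  assumes "D \<in> Forb_ind {digon, out_star 2, out_wheel3}"
  shows "\<exists>c. acyclic_coloring D {0, 1 :: nat} c" and "dichromatic_number D \<le> 2"
proof -
  interpret pair_digraph D
    using assms by (simp add: Forb_ind_def)
  interpret locally_out_transitive "parcs D"
    using Forb_ind_locally_out_transitive[OF assms] .
  obtain c where c: "acyclic_bipartition (parcs D) (pverts D) c"
    using star_colourable_prescribe[OF star_colourable, of "pverts D" "{}"] pair_finite_verts by blast
  have "acyclic (Restr (parcs D) {v \<in> pverts D. (of_bool (c v) :: nat) = i})" if "i \<in> {0, 1}" for i
  proof -
    have "{v \<in> pverts D. (of_bool (c v) :: nat) = i} = {v \<in> pverts D. c v = (i = 1)}"
      using that by auto
    then show ?thesis
      using c unfolding acyclic_bipartition_def by simp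
  qed
  then have "acyclic_coloring D {0, 1 :: nat} (of_bool \<circ> c)"
    unfolding acyclic_coloring_iff[OF pair_wf_digraph] by auto
  then show *: "\<exists>c. acyclic_coloring D {0, 1 :: nat} c"
    by blast
  then have "\<exists>(S :: nat set) c. finite S \<and> card S = 2 \<and> acyclic_coloring D S c"
    by (intro exI[of _ "{0, 1}"]) simp
  then show "dichromatic_number D \<le> 2"
    unfolding dichromatic_number_def by (rule Least_le)
qed

section \<open>The directed triangle and the dichromatic number of the class\<close>

definition triangle :: "'a \<Rightarrow> 'a \<Rightarrow> 'a \<Rightarrow> 'a pair_pre_digraph" where
  "triangle x y z = \<lparr>pverts = {x, y, z}, parcs = {(x, y), (y, z), (z, x)}\<rparr>"

text \<open>
  Every vertex of the triangle has a single out-neighbour, which excludes the star and the wheel, as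
  in both of them the centre \<open>0\<close> has the out-neighbours \<open>1\<close> and \<open>2\<close>.
\<close>

lemma triangle_in_Forb_ind:
  assumes "distinct [x, y, z]"
  shows "triangle x y z \<in> Forb_ind {digon, out_star 2, out_wheel3}"
proof -
  interpret pair_digraph "triangle x y z"
    using assms by unfold_locales (auto simp: triangle_def)
  have *: "(f 1, f 0) \<notin> parcs (triangle x y z)" "(f 0, f 2) \<notin> parcs (triangle x y z) \<or> f 1 = f 2"
    if "(f 0, f 1) \<in> parcs (triangle x y z)" for f :: "nat \<Rightarrow> 'a"
    using that assms by (auto simp: triangle_def)
  have "\<not> induced_embedding F (triangle x y z) f"
    if "F \<in> {digon, out_star 2, out_wheel3}" for F f
  proof
    assume "induced_embedding F (triangle x y z) f"
    then have inj: "inj_on f (pverts F)"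
      and arcs: "\<forall>u\<in>pverts F. \<forall>v\<in>pverts F. (u, v) \<in> parcs F \<longleftrightarrow> (f u, f v) \<in> parcs (triangle x y z)"
      by (auto simp: induced_embedding_def)
    have verts: "0 \<in> pverts F" "1 \<in> pverts F" "(0, 1) \<in> parcs F"
      using that by (auto simp: digon_def out_star_def out_wheel3_def)
    have "F = digon \<or> 2 \<in> pverts F \<and> (0, 2) \<in> parcs F"
      using that by (auto simp: out_star_def out_wheel3_def)
    then show False
    proof
      assume "F = digon"
      then have "(1, 0) \<in> parcs F"
        by (simp add: digon_def)
      then show False
        using *(1)[of f] arcs verts by blast
    next
      assume two: "2 \<in> pverts F \<and> (0, 2) \<in> parcs F"
      then have "f 1 = f 2"
        using *(2)[of f] arcs verts by blast
      then show False
        using inj_onD[OF inj] two verts(2) by fastforce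
    qed
  qed
  then show ?thesis
    using mem_Forb_ind_iff[OF pair_wf_digraph_forbidden] pair_digraph by blast
qed

lemma dichromatic_number_triangle:
  assumes "distinct [x, y, z]"
  shows "dichromatic_number (triangle x y z) = 2"
proof (rule antisym)
  note forb = triangle_in_Forb_ind[OF assms]
  show "dichromatic_number (triangle x y z) \<le> 2"
    using dichromatic_number_le_two(2)[OF forb] .
  have wf: "pair_wf_digraph (triangle x y z)"
    by unfold_locales (auto simp: triangle_def)
  let ?P = "\<lambda>k. \<exists>(S :: nat set) c. finite S \<and> card S = k \<and> acyclic_coloring (triangle x y z) S c"
  have "?P 2"
    using dichromatic_number_le_two(1)[OF forb] by (intro exI[of _ "{0, 1}"]) simp
  then have "?P (dichromatic_number (triangle x y z))"
    unfolding dichromatic_number_def by (rule LeastI)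
  then obtain S :: "nat set" and c where S: "finite S" "card S = dichromatic_number (triangle x y z)"
    and c: "c ` {x, y, z} \<subseteq> S"
      "\<And>i. i \<in> S \<Longrightarrow> acyclic (Restr {(x, y), (y, z), (z, x)} {v \<in> {x, y, z}. c v = i})"
    unfolding acyclic_coloring_iff[OF wf] by (auto simp: triangle_def)
  show "2 \<le> dichromatic_number (triangle x y z)"
  proof (rule ccontr)
    assume "\<not> ?thesis"
    then have "card S \<le> Suc 0"
      using S(2) by simp
    then have eq: "c y = c x" "c z = c x"
      using c(1) card_le_Suc0_iff_eq[OF S(1)] by auto
    let ?R = "Restr {(x, y), (y, z), (z, x)} {v \<in> {x, y, z}. c v = c x}"
    have "(x, y) \<in> ?R" "(y, z) \<in> ?R" "(z, x) \<in> ?R"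
      using eq by auto
    then have "(x, x) \<in> ?R\<^sup>+"
      by (meson r_into_trancl' trancl_trans)
    then show False
      using c(1) c(2)[of "c x"] by (auto simp: acyclic_def)
  qed
qed

theorem theorem2:
  fixes \<C> :: "'a::infinite pair_pre_digraph set"
  defines "\<C> \<equiv> Forb_ind {digon, out_star 2, out_wheel3}"
  shows "bdd_above (dichromatic_number ` \<C>) \<and> class_dichromatic_number \<C> = 2"
proof
  have bound: "n \<le> 2" if "n \<in> dichromatic_number ` \<C>" for n
    using that dichromatic_number_le_two(2) unfolding \<C>_def by blast
  show "bdd_above (dichromatic_number ` \<C>)"
    using bound by (rule bdd_aboveI)
  \<comment> \<open>An infinite type has the three vertices that the triangle needs.\<close>
  obtain A :: "'a set" where "card A = 3"
    using infinite_arbitrarily_large[OF infinite_UNIV] by blast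
  then obtain x y z :: 'a where "distinct [x, y, z]"
    by (auto simp: card_3_iff)
  then have "2 \<in> dichromatic_number ` \<C>"
    using dichromatic_number_triangle triangle_in_Forb_ind unfolding \<C>_def by (metis image_eqI)
  moreover have "finite (dichromatic_number ` \<C>)"
    using bound by (meson finite_nat_set_iff_bounded_le)
  ultimately show "class_dichromatic_number \<C> = 2"
    unfolding class_dichromatic_number_def using bound by (intro Max_eqI)
qed

end
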